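(* For each odd integer $k\ge 3$ and each integer $n$ with $2k\le n\le 3k-2$, we have $d(n,2(k-1),\chi=k)=k-1$.
   Context: All graphs are finite and simple. For a graph $G$, $\chi(G)$ denotes its chromatic number. A set $S$ of vertices of $G$ together with an assignment of colors to the vertices of $S$ is a defining set of the vertex coloring of $G$ if this partial coloring extends in exactly one way to a proper coloring of all vertices of $G$ with $\chi(G)$ colors. The defining number $d(G,\chi)$ is the minimum cardinality of a defining set of $G$. For integers $n,r,k$, $d(n,r,\chi=k)$ denotes the minimum of $d(G,\chi)$ over all $r$-regular graphs $G$ on $n$ vertices with $\chi(G)=k$. *)

theory Defs
  imports "Graph_Theory.Pair_Digraph" "HOL-Library.FuncSet" "HOL-Library.Extended_Nat"
begin

text \<open>
  A finite simple graph is a \<^locale>\<open>pair_graph\<close>: a finite, loop-free, symmetric relation on its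
  vertex set. Each undirected edge is a pair of opposite arcs, so the degree of a vertex is its
  out-degree.
\<close>

definition regular_graph :: "nat \<Rightarrow> 'a pair_pre_digraph \<Rightarrow> bool" where
  "regular_graph r G \<longleftrightarrow> pair_graph G \<and> (\<forall>v \<in> pverts G. out_degree (with_proj G) v = r)"

text \<open>
  Colorings are extensional functions, so that two colorings are equal iff they agree on all
  vertices; this matters for the uniqueness requirement in \<open>defining_set\<close>.
\<close>

definition proper_coloring :: "'a pair_pre_digraph \<Rightarrow> nat \<Rightarrow> ('a \<Rightarrow> nat) \<Rightarrow> bool" where
  "proper_coloring G k c \<longleftrightarrow>
     c \<in> pverts G \<rightarrow>\<^sub>E {..<k} \<and> (\<forall>(u, v) \<in> parcs G. c u \<noteq> c v)"

definition chromatic_number :: "'a pair_pre_digraph \<Rightarrow> nat" where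
  "chromatic_number G = (LEAST k. \<exists>c. proper_coloring G k c)"

definition defining_set :: "'a pair_pre_digraph \<Rightarrow> 'a set \<Rightarrow> ('a \<Rightarrow> nat) \<Rightarrow> bool" where
  "defining_set G S p \<longleftrightarrow>
     S \<subseteq> pverts G \<and> p \<in> S \<rightarrow>\<^sub>E {..<chromatic_number G} \<and>
     (\<exists>!c. proper_coloring G (chromatic_number G) c \<and> (\<forall>v \<in> S. c v = p v))"

definition defining_number :: "'a pair_pre_digraph \<Rightarrow> nat" where
  "defining_number G = (LEAST m. \<exists>S p. defining_set G S p \<and> card S = m)"

text \<open>
  Up to isomorphism, every finite graph has its vertices in \<^typ>\<open>nat\<close>. The minimum is taken in
  \<^typ>\<open>enat\<close>, where the infimum of a nonempty set is attained and that of the empty set is \<open>\<infinity>\<close>;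
  hence a finite value entails that a graph with the given parameters exists.
\<close>

definition min_defining_number :: "nat \<Rightarrow> nat \<Rightarrow> nat \<Rightarrow> enat" where
  "min_defining_number n r k =
     (INF G \<in> {G :: nat pair_pre_digraph.
                 regular_graph r G \<and> card (pverts G) = n \<and> chromatic_number G = k}.
        enat (defining_number G))"

end

theory Submission
  imports Defs
begin

text \<open>
  A partial colouring that misses two of the \<open>k\<close> colours never extends uniquely, because these two
  can be interchanged; hence \<open>k - 1\<close> is a lower bound.

  For the upper bound write \<open>n = 2 * (k - 1) + d + 1\<close> with \<open>1 \<le> d \<le> k - 1\<close> and construct the
  complement \<open>H\<close>, a \<open>d\<close>-regular graph whose vertices are partitioned into \<open>k\<close> cliques (the colour
  classes) and which has an independent set of size \<open>k\<close>. Fixing the colours of \<open>k - 1\<close> suitable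
  vertices from different classes forces all other colours one after another.
  If \<open>2 * (d - 1) \<le> k - 1\<close>, take for \<open>H\<close> a clique on \<open>d + 1\<close> vertices together with a \<open>d\<close>-regular
  bipartite graph. Otherwise \<open>k - 1 \<le> 2 * d - 4\<close>, as \<open>k - 1\<close> is even, and \<open>H\<close> is built from \<open>d - 1\<close>
  triangles and \<open>k - d + 1\<close> single edges as colour classes.
\<close>

section \<open>The lower bound\<close>

lemma proper_coloring_comp:
  assumes wf: "pair_wf_digraph G" and c: "proper_coloring G k c"
    and f: "inj_on f (c ` pverts G)" "f ` c ` pverts G \<subseteq> {..<l}"
  shows "proper_coloring G l (restrict (f \<circ> c) (pverts G))"
proof -
  interpret pair_wf_digraph G by (fact wf)
  show ?thesis
    unfolding proper_coloring_def
  proof (intro conjI ballI)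
    show "restrict (f \<circ> c) (pverts G) \<in> pverts G \<rightarrow>\<^sub>E {..<l}"
      using f(2) by (intro restrict_PiE_iff[THEN iffD2]) (auto simp: image_subset_iff)
  next
    fix e assume e: "e \<in> parcs G"
    obtain u v where uv: "e = (u, v)" by force
    have "u \<in> pverts G" "v \<in> pverts G" using e uv in_arcsD1 in_arcsD2 by auto
    moreover have "c u \<noteq> c v" using c e uv by (auto simp: proper_coloring_def)
    ultimately show "case e of (u, v) \<Rightarrow>
        restrict (f \<circ> c) (pverts G) u \<noteq> restrict (f \<circ> c) (pverts G) v"
      using inj_onD[OF f(1)] uv by auto
  qed
qed

lemma ex_proper_coloring:
  assumes "pair_graph G"
  shows "\<exists>k c. proper_coloring G k c"
proof -
  interpret pair_graph G by fact
  obtain f :: "'a \<Rightarrow> nat" where f: "bij_betw f (pverts G) {..<card (pverts G)}"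
    using ex_bij_betw_finite_nat[OF pair_finite_verts] by (auto simp: atLeast0LessThan)
  have "proper_coloring G (card (pverts G)) (restrict f (pverts G))"
    unfolding proper_coloring_def
  proof (intro conjI ballI)
    show "restrict f (pverts G) \<in> pverts G \<rightarrow>\<^sub>E {..<card (pverts G)}"
      using f by (auto simp: bij_betw_def)
  next
    fix e assume "e \<in> parcs G"
    then have "fst e \<noteq> snd e" "fst e \<in> pverts G" "snd e \<in> pverts G"
      by (auto simp: pair_no_loops arc_fst_in_verts arc_snd_in_verts)
    moreover from this have "f (fst e) \<noteq> f (snd e)"
      using bij_betw_imp_inj_on[OF f] by (auto dest: inj_onD)
    ultimately show "case e of (u, v) \<Rightarrow> restrict f (pverts G) u \<noteq> restrict f (pverts G) v"
      by (simp add: case_prod_beta)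
  qed
  then show ?thesis by blast
qed

lemma proper_coloring_chromatic_number:
  assumes "pair_graph G"
  shows "\<exists>c. proper_coloring G (chromatic_number G) c"
  unfolding chromatic_number_def using ex_proper_coloring[OF assms] by (rule LeastI_ex)

lemma chromatic_number_le: "proper_coloring G k c \<Longrightarrow> chromatic_number G \<le> k"
  unfolding chromatic_number_def by (rule Least_le) blast

text \<open>Otherwise the remaining colours could be renumbered to give a proper colouring with one
  colour fewer.\<close>

lemma proper_coloring_uses_color:
  assumes wf: "pair_wf_digraph G" and c: "proper_coloring G (chromatic_number G) c"
    and a: "a < chromatic_number G"
  shows "a \<in> c ` pverts G"
proof (rule ccontr)
  assume na: "a \<notin> c ` pverts G"
  define k where "k = chromatic_number G"
  have "card ({..<k} - {a}) = k - 1"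
    using a by (simp add: k_def)
  then obtain f where f: "bij_betw f ({..<k} - {a}) {..<k - 1}"
    using ex_bij_betw_finite_nat[of "{..<k} - {a}"] by (auto simp: atLeast0LessThan)
  have c_in: "c ` pverts G \<subseteq> {..<k} - {a}"
    using c na by (auto simp: proper_coloring_def k_def)
  have "proper_coloring G (k - 1) (restrict (f \<circ> c) (pverts G))"
  proof (rule proper_coloring_comp[OF wf c])
    show "inj_on f (c ` pverts G)"
      using f c_in by (auto simp: bij_betw_def intro: inj_on_subset)
    show "f ` c ` pverts G \<subseteq> {..<k - 1}"
      using bij_betw_imp_surj_on[OF f] image_mono[OF c_in, of f] by simp
  qed
  then have "k \<le> k - 1" unfolding k_def by (rule chromatic_number_le)
  then show False using a by (simp add: k_def)
qed

text \<open>Two colours missed by the partial colouring could be interchanged.\<close>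

lemma card_defining_set_ge:
  assumes G: "pair_graph G" and D: "defining_set G S p"
  shows "chromatic_number G - 1 \<le> card S"
proof (rule ccontr)
  define k where "k = chromatic_number G"
  interpret pair_graph G by (fact G)
  assume "\<not> chromatic_number G - 1 \<le> card S"
  then have lt: "card S + 1 < k" by (simp add: k_def)
  from D have S: "S \<subseteq> pverts G" and p: "p \<in> S \<rightarrow>\<^sub>E {..<k}"
    and ex1: "\<exists>!c. proper_coloring G k c \<and> (\<forall>v \<in> S. c v = p v)"
    by (auto simp: defining_set_def k_def)
  from ex1 obtain c where c: "proper_coloring G k c" and cp: "\<forall>v \<in> S. c v = p v" by blast
  have finS: "finite S" using S pair_finite_verts finite_subset by blast
  have "card (p ` S) \<le> card S" using finS by (rule card_image_le)
  then have "2 \<le> card ({..<k} - p ` S)"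
    using lt finS by (subst card_Diff_subset) (use p in auto)
  then obtain a b where ab: "a \<in> {..<k} - p ` S" "b \<in> {..<k} - p ` S" "a \<noteq> b"
    by (metis card_2_iff' card_le_Suc0_iff_eq finite_Diff finite_lessThan not_less_eq_eq numeral_2_eq_2)
  define c' where "c' = restrict (transpose a b \<circ> c) (pverts G)"
  have "proper_coloring G k c'"
    unfolding c'_def
    by (rule proper_coloring_comp[OF pair_wf_digraph_axioms c])
      (use ab c in \<open>auto simp: proper_coloring_def transpose_def\<close>)
  moreover have "\<forall>v \<in> S. c' v = p v"
    using S cp ab by (auto simp: c'_def transpose_def)
  ultimately have "c' = c" using ex1 c cp by blast
  \<comment> \<open>An optimal colouring does use \<open>a\<close>, so the interchange really
    changes \<open>c\<close>.\<close>
  obtain v where v: "v \<in> pverts G" "c v = a"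
    using proper_coloring_uses_color[OF pair_wf_digraph_axioms, of c a] c ab by (auto simp: k_def)
  then have "c' v = b" by (simp add: c'_def)
  with \<open>c' = c\<close> v ab show False by simp
qed

lemma defining_number_ge:
  assumes G: "pair_graph G"
  shows "chromatic_number G - 1 \<le> defining_number G"
proof -
  obtain c where c: "proper_coloring G (chromatic_number G) c"
    using proper_coloring_chromatic_number[OF G] by blast
  \<comment> \<open>Fixing all vertices is a defining set, so the \<open>LEAST\<close> is
    attained.\<close>
  then have "defining_set G (pverts G) c"
    unfolding defining_set_def proper_coloring_def by (auto intro: PiE_ext intro!: ex1I[of _ c])
  then have "\<exists>m S p. defining_set G S p \<and> card S = m" by blast
  then have "\<exists>S p. defining_set G S p \<and> card S = defining_number G"
    unfolding defining_number_def by (rule LeastI_ex)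
  then show ?thesis using card_defining_set_ge[OF G] by metis
qed

section \<open>Forced colourings\<close>

text \<open>
  The graph is given by its complement \<open>H\<close>, so colour classes are cliques of \<open>H\<close>. The vertices of
  rank 0 form the defining set; every other vertex is forced by neighbours of smaller rank.
\<close>

locale forced_coloring =
  fixes X :: "'a set" and H :: "'a \<Rightarrow> 'a \<Rightarrow> bool" and col rk :: "'a \<Rightarrow> nat" and K :: "'a set"
    and d k :: nat
  assumes finite_X: "finite X"
    and card_X: "card X = 2 * (k - 1) + d + 1"
    and H_sym: "H x y \<Longrightarrow> H y x"
    and H_irrefl: "\<not> H x x"
    and H_regular: "x \<in> X \<Longrightarrow> card {y \<in> X. H x y} = d"
    and col_less: "x \<in> X \<Longrightarrow> col x < k"
    and col_eq: "x \<in> X \<Longrightarrow> y \<in> X \<Longrightarrow> x \<noteq> y \<Longrightarrow> col x = col y \<Longrightarrow> H x y"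
    and K_subset: "K \<subseteq> X"
    and card_K: "card K = k"
    and K_indep: "x \<in> K \<Longrightarrow> y \<in> K \<Longrightarrow> \<not> H x y"
    and card_rank_0: "card {x \<in> X. rk x = 0} = k - 1"
    and forced: "x \<in> X \<Longrightarrow> rk x > 0 \<Longrightarrow> c < k \<Longrightarrow> c \<noteq> col x
      \<Longrightarrow> \<exists>y \<in> X. \<not> H x y \<and> col y = c \<and> rk y < rk x"
begin

lemma min_defining_number_le: "min_defining_number (card X) (2 * (k - 1)) k \<le> enat (k - 1)"
proof -
  define n where "n = card X"
  \<comment> \<open>The minimum ranges over graphs on natural numbers, so \<open>X\<close> is
    relabelled.\<close>
  obtain h where h: "bij_betw h {..<n} X"
    using ex_bij_betw_nat_finite[OF finite_X] by (auto simp: n_def atLeast0LessThan)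
  have hX: "h i \<in> X" if "i < n" for i using h that by (auto simp: bij_betw_def)
  have h_inj: "h i = h j \<longleftrightarrow> i = j" if "i < n" "j < n" for i j
    using h that by (auto simp: bij_betw_def inj_on_def)
  have h_surj: "\<exists>i<n. h i = x" if "x \<in> X" for x
    using h that by (auto simp: bij_betw_def)
  have card_pre: "card {i. i < n \<and> P (h i)} = card {x \<in> X. P x}" for P
    by (rule bij_betw_same_card[of h])
      (use h in \<open>auto simp: bij_betw_def inj_on_def\<close>)
  define E where "E = {(i, j). i < n \<and> j < n \<and> i \<noteq> j \<and> \<not> H (h i) (h j)}"
  define G :: "nat pair_pre_digraph" where "G = \<lparr>pverts = {..<n}, parcs = E\<rparr>"
  have [simp]: "pverts G = {..<n}" "parcs G = E" by (simp_all add: G_def)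
  have "E \<subseteq> {..<n} \<times> {..<n}" by (auto simp: E_def)
  then have "finite E" by (rule finite_subset) simp
  then have pg: "pair_graph G"
    by unfold_locales (auto simp: E_def symmetric_def sym_def dest: H_sym)
  have deg: "out_degree (with_proj G) i = 2 * (k - 1)" if i: "i < n" for i
  proof -
    have "out_arcs (with_proj G) i = Pair i ` {j. j < n \<and> h i \<noteq> h j \<and> \<not> H (h i) (h j)}"
      using i by (auto simp: out_arcs_def E_def h_inj)
    then have "out_degree (with_proj G) i = card {y \<in> X. h i \<noteq> y \<and> \<not> H (h i) y}"
      unfolding out_degree_def
      by (simp add: card_image inj_on_def card_pre[of "\<lambda>y. h i \<noteq> y \<and> \<not> H (h i) y"])
    also have "{y \<in> X. h i \<noteq> y \<and> \<not> H (h i) y} = X - insert (h i) {y \<in> X. H (h i) y}"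
      by auto
    also have "card \<dots> = card X - Suc d"
      using finite_X hX[OF i] H_irrefl by (subst card_Diff_subset) (auto simp: H_regular)
    finally show ?thesis by (simp add: card_X)
  qed
  have reg: "regular_graph (2 * (k - 1)) G"
    using pg deg by (simp add: regular_graph_def)
  define c where "c = restrict (col \<circ> h) {..<n}"
  have c: "proper_coloring G k c"
    unfolding proper_coloring_def using hX col_less h_inj col_eq
    by (fastforce simp: c_def E_def)
  have chi: "chromatic_number G = k"
  proof (rule antisym)
    show "chromatic_number G \<le> k" by (rule chromatic_number_le[OF c])
    obtain c' where c': "proper_coloring G (chromatic_number G) c'"
      using proper_coloring_chromatic_number[OF pg] by blast
    \<comment> \<open>An independent set of \<open>H\<close> is a clique of \<open>G\<close>, whose
      \<open>k\<close> vertices need distinct colours.\<close>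
    define L where "L = {i. i < n \<and> h i \<in> K}"
    have "{x \<in> X. x \<in> K} = K" using K_subset by auto
    then have "card L = k" unfolding L_def card_pre[of "\<lambda>x. x \<in> K"] by (simp add: card_K)
    moreover have "inj_on c' L"
    proof (rule inj_onI, rule ccontr)
      fix i j assume ij: "i \<in> L" "j \<in> L" "c' i = c' j" "i \<noteq> j"
      then have "(i, j) \<in> E" using K_indep by (auto simp: L_def E_def)
      then show False using c' ij by (auto simp: proper_coloring_def)
    qed
    then have "card L \<le> card {..<chromatic_number G}"
      by (rule card_inj_on_le) (use c' in \<open>auto simp: proper_coloring_def L_def\<close>)
    ultimately show "k \<le> chromatic_number G" by simp
  qed
  define S where "S = {i. i < n \<and> rk (h i) = 0}"
  have cS: "card S = k - 1"
    unfolding S_def card_pre[of "\<lambda>x. rk x = 0"] by (rule card_rank_0)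
  \<comment> \<open>Induction on the rank: the neighbours of smaller rank already carry every colour
    except \<open>col (h i)\<close>.\<close>
  have unique: "c' i = c i"
    if c': "proper_coloring G k c'" and eq: "\<forall>i\<in>S. c' i = c i" and "i < n" for c' i
    using \<open>i < n\<close>
  proof (induction "rk (h i)" arbitrary: i rule: less_induct)
    case less
    show ?case
    proof (cases "rk (h i) = 0")
      case True
      then show ?thesis using eq less.prems by (simp add: S_def)
    next
      case False
      show ?thesis
      proof (rule ccontr)
        assume ne: "c' i \<noteq> c i"
        have "c' i < k" using c' less.prems by (auto simp: proper_coloring_def)
        with ne False less.prems obtain y
          where y: "y \<in> X" "\<not> H (h i) y" "col y = c' i" "rk y < rk (h i)"
          using forced[of "h i" "c' i"] hX[of i] by (auto simp: c_def)
        then obtain j where j: "j < n" "h j = y" using h_surj by blast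
        then have "c' j = c' i" using less.hyps[of j] y by (simp add: c_def)
        moreover have "(i, j) \<in> E" using j y less.prems by (auto simp: E_def)
        ultimately show False using c' by (auto simp: proper_coloring_def)
      qed
    qed
  qed
  have "defining_set G S (restrict c S)"
    unfolding defining_set_def chi
  proof (intro conjI ex1I[of _ c])
    show "S \<subseteq> pverts G" by (auto simp: S_def)
    show "restrict c S \<in> S \<rightarrow>\<^sub>E {..<k}"
      using c by (auto simp: proper_coloring_def S_def)
    show "proper_coloring G k c" by (fact c)
    show "\<forall>v\<in>S. c v = restrict c S v" by simp
  next
    fix c' assume c': "proper_coloring G k c' \<and> (\<forall>v\<in>S. c' v = restrict c S v)"
    then have "c' i = c i" if "i < n" for i using unique[of c' i] that by simp
    then show "c' = c"
      using c c' unfolding proper_coloring_def by (intro PiE_ext[of c' "{..<n}" "\<lambda>_. {..<k}" c]) auto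
  qed
  then have "defining_number G \<le> k - 1"
    unfolding defining_number_def using cS by (intro Least_le) blast
  moreover have "min_defining_number n (2 * (k - 1)) k \<le> enat (defining_number G)"
    unfolding min_defining_number_def by (rule INF_lower) (use reg chi in simp)
  ultimately show ?thesis unfolding n_def by (meson enat_ord_simps(1) order_trans)
qed

end

section \<open>Cyclic shifts\<close>

lemma bij_betw_shift_mod:
  fixes a h :: nat
  shows "bij_betw (\<lambda>j. (a + j) mod h) {..<h} {..<h}"
proof -
  have "inj_on (\<lambda>j. (a + j) mod h) {..<h}"
  proof (rule linorder_inj_onI)
    fix x y assume xy: "x < y" "x \<in> {..<h}" "y \<in> {..<h}"
    show "(a + x) mod h \<noteq> (a + y) mod h"
    proof
      assume "(a + x) mod h = (a + y) mod h"
      then have "h dvd y - x" using xy mod_eq_dvd_iff_nat[of "a + x" "a + y" h] by simp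
      then show False using xy by (auto dest: dvd_imp_le)
    qed
  qed auto
  moreover have "(\<lambda>j. (a + j) mod h) ` {..<h} \<subseteq> {..<h}" by auto
  ultimately show ?thesis by (simp add: bij_betw_def endo_inj_surj)
qed

text \<open>The shift permutes the residues, so each value below \<open>c\<close> is hit once. This
  gives the degrees in the cyclic bands below.\<close>

lemma card_shift_mod_less:
  fixes a h c :: nat
  assumes "c \<le> h"
  shows "card {j. j < h \<and> (a + j) mod h < c} = c"
proof -
  have "bij_betw (\<lambda>j. (a + j) mod h) {j. j < h \<and> (a + j) mod h < c} {..<c}"
    unfolding bij_betw_def
  proof
    show "inj_on (\<lambda>j. (a + j) mod h) {j. j < h \<and> (a + j) mod h < c}"
      by (rule inj_on_subset[OF bij_betw_imp_inj_on[OF bij_betw_shift_mod[of a h]]]) auto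
    show "(\<lambda>j. (a + j) mod h) ` {j. j < h \<and> (a + j) mod h < c} = {..<c}"
    proof
      show "{..<c} \<subseteq> (\<lambda>j. (a + j) mod h) ` {j. j < h \<and> (a + j) mod h < c}"
      proof
        fix x assume x: "x \<in> {..<c}"
        then have "x \<in> (\<lambda>j. (a + j) mod h) ` {..<h}"
          using assms bij_betw_imp_surj_on[OF bij_betw_shift_mod[of a h]] by simp
        then show "x \<in> (\<lambda>j. (a + j) mod h) ` {j. j < h \<and> (a + j) mod h < c}" using x by auto
      qed
    qed auto
  qed
  then show ?thesis by (simp add: bij_betw_same_card)
qed

text \<open>The substitution of \<open>h - 1 - j\<close> for \<open>j\<close> turns the reflection
  into a shift by \<open>Suc a\<close>, since \<open>h - (h - 1 - j) = Suc j\<close>.\<close>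

lemma card_reflect_mod_less:
  fixes a h c :: nat
  assumes "c \<le> h"
  shows "card {j. j < h \<and> (a + (h - j)) mod h < c} = c"
proof -
  have "bij_betw (\<lambda>j. h - 1 - j) {j. j < h \<and> (a + (h - j)) mod h < c}
      {j. j < h \<and> (Suc a + j) mod h < c}"
    by (rule bij_betw_byWitness[of _ "\<lambda>j. h - 1 - j"])
      (auto simp: image_subset_iff Suc_diff_Suc)
  then show ?thesis using card_shift_mod_less[OF assms, of "Suc a"] by (simp add: bij_betw_same_card)
qed

section \<open>Complements with a clique component\<close>

text \<open>
  The \<open>BT i\<close> form a clique component. The rest is bipartite with sides \<open>{BS False i, BW True i}\<close> and
  \<open>{BS True i, BW False i}\<close>; the two-element classes are \<open>{BS p i, BW p i}\<close>.
\<close>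

datatype bip_vertex = BT nat | BS bool nat | BW bool nat

definition bip_verts :: "nat \<Rightarrow> nat \<Rightarrow> bip_vertex set" where
  "bip_verts h d = BT ` {..d} \<union> case_prod BS ` (UNIV \<times> {..<h}) \<union> case_prod BW ` (UNIV \<times> {..<h})"

text \<open>The sum \<open>i + j\<close> makes the band symmetric. It contributes degree
  \<open>d - 1\<close>; the partner in the colour class is the remaining neighbour.\<close>

fun bip_adj :: "nat \<Rightarrow> nat \<Rightarrow> bip_vertex \<Rightarrow> bip_vertex \<Rightarrow> bool" where
  "bip_adj h d (BT i) (BT j) \<longleftrightarrow> i \<noteq> j"
| "bip_adj h d (BS p i) (BS q j) \<longleftrightarrow> p \<noteq> q \<and> (i + j) mod h < d - 1"
| "bip_adj h d (BW p i) (BW q j) \<longleftrightarrow> p \<noteq> q \<and> (i + j) mod h < d - 1"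
| "bip_adj h d (BS p i) (BW q j) \<longleftrightarrow> p = q \<and> i = j"
| "bip_adj h d (BW p i) (BS q j) \<longleftrightarrow> p = q \<and> i = j"
| "bip_adj h d _ _ \<longleftrightarrow> False"

fun bip_col :: "nat \<Rightarrow> bip_vertex \<Rightarrow> nat" where
  "bip_col h (BT i) = 2 * h"
| "bip_col h (BS p i) = (if p then h + i else i)"
| "bip_col h (BW p i) = (if p then h + i else i)"

fun bip_rank :: "bip_vertex \<Rightarrow> nat" where
  "bip_rank (BS p i) = 0"
| "bip_rank (BT i) = 1"
| "bip_rank (BW p i) = 2"

text \<open>A band of width \<open>d - 1\<close> fits into the period \<open>h\<close>. The
  independent set is one side of the bipartite part plus one clique vertex. The \<open>BS\<close>
  vertices show all colours but \<open>2 * h\<close>, which forces the \<open>BT\<close>; together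
  these force the \<open>BW\<close>.\<close>

lemma bip_forced_coloring:
  assumes d: "d \<ge> 1" "d - 1 \<le> h"
  shows "forced_coloring (bip_verts h d) (bip_adj h d) (bip_col h) bip_rank
    (insert (BT 0) (BS False ` {..<h} \<union> BW True ` {..<h})) d (2 * h + 1)"
proof
  have mem: "BT i \<in> bip_verts h d \<longleftrightarrow> i \<le> d" "BS p i \<in> bip_verts h d \<longleftrightarrow> i < h"
    "BW p i \<in> bip_verts h d \<longleftrightarrow> i < h" for i p
    by (auto simp: bip_verts_def)
  show "finite (bip_verts h d)" by (simp add: bip_verts_def)
  have "card (bip_verts h d) = card (BT ` {..d}) + card (case_prod BS ` (UNIV \<times> {..<h}))
      + card (case_prod BW ` (UNIV \<times> {..<h}))"
    unfolding bip_verts_def by (subst card_Un_disjoint; (subst card_Un_disjoint)?) auto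
  also have "\<dots> = d + 1 + 2 * h + 2 * h"
    by (subst (1 2 3) card_image) (auto simp: inj_on_def card_cartesian_product)
  finally show "card (bip_verts h d) = 2 * (2 * h + 1 - 1) + d + 1" by simp
  show "bip_adj h d x y \<Longrightarrow> bip_adj h d y x" for x y
    by (cases x; cases y) (auto simp: add.commute)
  show "\<not> bip_adj h d x x" for x by (cases x) auto
  show "card {y \<in> bip_verts h d. bip_adj h d x y} = d" if x: "x \<in> bip_verts h d" for x
  proof (cases x)
    case (BT i)
    have N: "{y \<in> bip_verts h d. bip_adj h d x y} = BT ` ({..d} - {i})"
      by (auto simp: BT mem elim!: bip_adj.elims)
    then show ?thesis using x by (simp add: BT mem card_image inj_on_def)
  next
    case (BS p i)
    have N: "{y \<in> bip_verts h d. bip_adj h d x y}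
        = insert (BW p i) (BS (\<not> p) ` {j. j < h \<and> (i + j) mod h < d - 1})"
      using x by (auto simp: BS mem elim!: bip_adj.elims)
    show ?thesis unfolding N using card_shift_mod_less[OF d(2)] d(1)
      by (subst card_insert_disjoint) (auto simp: card_image inj_on_def)
  next
    case (BW p i)
    have N: "{y \<in> bip_verts h d. bip_adj h d x y}
        = insert (BS p i) (BW (\<not> p) ` {j. j < h \<and> (i + j) mod h < d - 1})"
      using x by (auto simp: BW mem elim!: bip_adj.elims)
    show ?thesis unfolding N using card_shift_mod_less[OF d(2)] d(1)
      by (subst card_insert_disjoint) (auto simp: card_image inj_on_def)
  qed
  show "bip_col h x < 2 * h + 1" if "x \<in> bip_verts h d" for x
    using that by (cases x) (auto simp: mem)
  show "bip_adj h d x y"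
    if "x \<in> bip_verts h d" "y \<in> bip_verts h d" "x \<noteq> y" "bip_col h x = bip_col h y" for x y
    using that by (cases x; cases y) (auto simp: mem split: if_splits)
  show "insert (BT 0) (BS False ` {..<h} \<union> BW True ` {..<h}) \<subseteq> bip_verts h d"
    by (auto simp: mem)
  show "card (insert (BT 0) (BS False ` {..<h} \<union> BW True ` {..<h})) = 2 * h + 1"
    by (subst card_insert_disjoint, simp, force, subst card_Un_disjoint)
      (auto simp: card_image inj_on_def)
  show "\<not> bip_adj h d x y"
    if "x \<in> insert (BT 0) (BS False ` {..<h} \<union> BW True ` {..<h})"
      "y \<in> insert (BT 0) (BS False ` {..<h} \<union> BW True ` {..<h})" for x y
    using that by auto
  have "{x \<in> bip_verts h d. bip_rank x = 0} = case_prod BS ` (UNIV \<times> {..<h})"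
    by (auto simp: bip_verts_def)
  then show "card {x \<in> bip_verts h d. bip_rank x = 0} = 2 * h + 1 - 1"
    by (simp add: card_image inj_on_def card_cartesian_product)
  show "\<exists>y\<in>bip_verts h d. \<not> bip_adj h d x y \<and> bip_col h y = c \<and> bip_rank y < bip_rank x"
    if x: "x \<in> bip_verts h d" "0 < bip_rank x" "c < 2 * h + 1" "c \<noteq> bip_col h x" for x c
  proof -
    \<comment> \<open>The vertex of least rank with colour \<open>c\<close>, up to the choice among
      the \<open>BT\<close>.\<close>
    define y where "y = (if c < h then BS False c else if c < 2 * h then BS True (c - h) else BT 0)"
    have "y \<in> bip_verts h d \<and> \<not> bip_adj h d x y \<and> bip_col h y = c \<and> bip_rank y < bip_rank x"
      using x by (cases x) (auto simp: y_def mem split: if_splits)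
    then show ?thesis by blast
  qed
qed

section \<open>Complements with triangular colour classes\<close>

text \<open>
  The colour classes are \<open>{TV, TA}\<close>, \<open>{TS i, TW i, TB i}\<close> and \<open>{TP i, TQ i}\<close>. The cyclic band between
  \<open>TW\<close> and \<open>TB\<close> contains the diagonal, so that the triangles are cliques; its width is what is left
  of the degree \<open>e + 1\<close>.
\<close>

datatype tri_vertex = TV | TA | TS nat | TW nat | TB nat | TP nat | TQ nat

definition tri_verts :: "nat \<Rightarrow> nat \<Rightarrow> tri_vertex set" where
  "tri_verts e r = {TV, TA} \<union> (TS ` {..<e} \<union> TW ` {..<e} \<union> TB ` {..<e}) \<union> (TP ` {..<r} \<union> TQ ` {..<r})"

fun tri_adj :: "nat \<Rightarrow> nat \<Rightarrow> tri_vertex \<Rightarrow> tri_vertex \<Rightarrow> bool" where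
  "tri_adj e r TV TA \<longleftrightarrow> True"
| "tri_adj e r TA TV \<longleftrightarrow> True"
| "tri_adj e r TV (TB j) \<longleftrightarrow> True"
| "tri_adj e r (TB j) TV \<longleftrightarrow> True"
| "tri_adj e r TA (TW j) \<longleftrightarrow> True"
| "tri_adj e r (TW j) TA \<longleftrightarrow> True"
| "tri_adj e r (TS i) (TS j) \<longleftrightarrow> i \<noteq> j"
| "tri_adj e r (TS i) (TW j) \<longleftrightarrow> i = j"
| "tri_adj e r (TW i) (TS j) \<longleftrightarrow> i = j"
| "tri_adj e r (TS i) (TB j) \<longleftrightarrow> i = j"
| "tri_adj e r (TB i) (TS j) \<longleftrightarrow> i = j"
| "tri_adj e r (TW i) (TB j) \<longleftrightarrow> (i + (e - j)) mod e < e - 1 - r"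
| "tri_adj e r (TB j) (TW i) \<longleftrightarrow> (i + (e - j)) mod e < e - 1 - r"
| "tri_adj e r (TP i) (TQ j) \<longleftrightarrow> i = j"
| "tri_adj e r (TQ i) (TP j) \<longleftrightarrow> i = j"
| "tri_adj e r (TP i) (TW j) \<longleftrightarrow> True"
| "tri_adj e r (TW i) (TP j) \<longleftrightarrow> True"
| "tri_adj e r (TQ i) (TB j) \<longleftrightarrow> True"
| "tri_adj e r (TB i) (TQ j) \<longleftrightarrow> True"
| "tri_adj e r _ _ \<longleftrightarrow> False"

fun tri_col :: "nat \<Rightarrow> nat \<Rightarrow> tri_vertex \<Rightarrow> nat" where
  "tri_col e r (TS i) = i"
| "tri_col e r (TW i) = i"
| "tri_col e r (TB i) = i"
| "tri_col e r (TP i) = e + i"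
| "tri_col e r (TQ i) = e + i"
| "tri_col e r TV = e + r"
| "tri_col e r TA = e + r"

text \<open>\<open>TW\<close> comes last because in \<open>H\<close> it is joined to every
  \<open>TP\<close>; it must see the colours of the single edges on the \<open>TQ\<close>.\<close>

fun tri_rank :: "tri_vertex \<Rightarrow> nat" where
  "tri_rank (TS i) = 0"
| "tri_rank (TP i) = 0"
| "tri_rank TV = 1"
| "tri_rank TA = 1"
| "tri_rank (TQ i) = 2"
| "tri_rank (TB i) = 2"
| "tri_rank (TW i) = 3"

lemma tri_forced_coloring:
  assumes r: "r + 2 \<le> e"
  shows "forced_coloring (tri_verts e r) (tri_adj e r) (tri_col e r) tri_rank
    (insert TV (TW ` {..<e} \<union> TQ ` {..<r})) (e + 1) (e + r + 1)"
proof
  have mem: "TV \<in> tri_verts e r" "TA \<in> tri_verts e r" "TS i \<in> tri_verts e r \<longleftrightarrow> i < e"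
    "TW i \<in> tri_verts e r \<longleftrightarrow> i < e" "TB i \<in> tri_verts e r \<longleftrightarrow> i < e"
    "TP i \<in> tri_verts e r \<longleftrightarrow> i < r" "TQ i \<in> tri_verts e r \<longleftrightarrow> i < r" for i
    by (auto simp: tri_verts_def)
  have inj: "inj_on TS M" "inj_on TW M" "inj_on TB M" "inj_on TP M" "inj_on TQ M" for M
    by (auto simp: inj_on_def)
  show "finite (tri_verts e r)" by (simp add: tri_verts_def)
  have "card (TS ` {..<e} \<union> TW ` {..<e} \<union> TB ` {..<e}) = e + e + e"
    by (subst card_Un_disjoint; (subst card_Un_disjoint)?) (auto simp: card_image inj)
  moreover have "card (TP ` {..<r} \<union> TQ ` {..<r}) = r + r"
    by (subst card_Un_disjoint) (auto simp: card_image inj)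
  ultimately have "card (tri_verts e r) = 2 + (e + e + e) + (r + r)"
    unfolding tri_verts_def by (subst card_Un_disjoint; (subst card_Un_disjoint)?) auto
  then show "card (tri_verts e r) = 2 * (e + r + 1 - 1) + (e + 1) + 1" by simp
  show "tri_adj e r x y \<Longrightarrow> tri_adj e r y x" for x y
    by (cases x; cases y) auto
  show "\<not> tri_adj e r x x" for x by (cases x) auto
  show "card {y \<in> tri_verts e r. tri_adj e r x y} = e + 1" if x: "x \<in> tri_verts e r" for x
  proof (cases x)
    case TV
    have N: "{y \<in> tri_verts e r. tri_adj e r x y} = insert TA (TB ` {..<e})"
      by (auto simp: TV mem elim!: tri_adj.elims)
    show ?thesis unfolding N by (subst card_insert_disjoint) (auto simp: card_image inj)
  next
    case TA
    have N: "{y \<in> tri_verts e r. tri_adj e r x y} = insert TV (TW ` {..<e})"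
      by (auto simp: TA mem elim!: tri_adj.elims)
    show ?thesis unfolding N by (subst card_insert_disjoint) (auto simp: card_image inj)
  next
    case (TS i)
    have N: "{y \<in> tri_verts e r. tri_adj e r x y} = {TW i, TB i} \<union> TS ` ({..<e} - {i})"
      using x by (auto simp: TS mem elim!: tri_adj.elims)
    show ?thesis unfolding N using x
      by (subst card_Un_disjoint) (auto simp: card_image inj TS mem)
  next
    case (TW i)
    have N: "{y \<in> tri_verts e r. tri_adj e r x y}
        = {TA, TS i} \<union> (TP ` {..<r} \<union> TB ` {j. j < e \<and> (i + (e - j)) mod e < e - 1 - r})"
      using x by (auto simp: TW mem elim!: tri_adj.elims)
    have "card (TP ` {..<r} \<union> TB ` {j. j < e \<and> (i + (e - j)) mod e < e - 1 - r})
        = r + (e - 1 - r)"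
      using card_reflect_mod_less[of "e - 1 - r" e i]
      by (subst card_Un_disjoint) (auto simp: card_image inj)
    then show ?thesis unfolding N using r
      by (subst card_Un_disjoint) auto
  next
    case (TB i)
    \<comment> \<open>Seen from \<open>TB\<close> the running index is added, so the band is a
      shift; seen from \<open>TW\<close> it is subtracted, a reflection.\<close>
    have N: "{y \<in> tri_verts e r. tri_adj e r x y}
        = {TV, TS i} \<union> (TQ ` {..<r} \<union> TW ` {j. j < e \<and> ((e - i) + j) mod e < e - 1 - r})"
      using x by (auto simp: TB mem add.commute elim!: tri_adj.elims)
    have "card (TQ ` {..<r} \<union> TW ` {j. j < e \<and> ((e - i) + j) mod e < e - 1 - r})
        = r + (e - 1 - r)"
      using card_shift_mod_less[of "e - 1 - r" e "e - i"]
      by (subst card_Un_disjoint) (auto simp: card_image inj)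
    then show ?thesis unfolding N using r
      by (subst card_Un_disjoint) auto
  next
    case (TP i)
    have N: "{y \<in> tri_verts e r. tri_adj e r x y} = insert (TQ i) (TW ` {..<e})"
      using x by (auto simp: TP mem elim!: tri_adj.elims)
    show ?thesis unfolding N by (subst card_insert_disjoint) (auto simp: card_image inj)
  next
    case (TQ i)
    have N: "{y \<in> tri_verts e r. tri_adj e r x y} = insert (TP i) (TB ` {..<e})"
      using x by (auto simp: TQ mem elim!: tri_adj.elims)
    show ?thesis unfolding N by (subst card_insert_disjoint) (auto simp: card_image inj)
  qed
  show "tri_col e r x < e + r + 1" if "x \<in> tri_verts e r" for x
    using that by (cases x) (auto simp: mem)
  \<comment> \<open>For \<open>TW i\<close> and \<open>TB i\<close> the offset is
    \<open>e mod e = 0\<close>, which lies in the band as \<open>r + 2 \<le> e\<close> makes its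
    width positive.\<close>
  show "tri_adj e r x y"
    if "x \<in> tri_verts e r" "y \<in> tri_verts e r" "x \<noteq> y" "tri_col e r x = tri_col e r y" for x y
    using that r by (cases x; cases y) (auto simp: mem)
  show "insert TV (TW ` {..<e} \<union> TQ ` {..<r}) \<subseteq> tri_verts e r"
    by (auto simp: mem)
  have "card (TW ` {..<e} \<union> TQ ` {..<r}) = e + r"
    by (subst card_Un_disjoint) (auto simp: card_image inj)
  then show "card (insert TV (TW ` {..<e} \<union> TQ ` {..<r})) = e + r + 1"
    by (subst card_insert_disjoint) auto
  show "\<not> tri_adj e r x y"
    if "x \<in> insert TV (TW ` {..<e} \<union> TQ ` {..<r})" "y \<in> insert TV (TW ` {..<e} \<union> TQ ` {..<r})" for x y
    using that by auto
  have "{x \<in> tri_verts e r. tri_rank x = 0} = TS ` {..<e} \<union> TP ` {..<r}"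
    by (auto simp: tri_verts_def)
  moreover have "card (TS ` {..<e} \<union> TP ` {..<r}) = e + r"
    by (subst card_Un_disjoint) (auto simp: card_image inj)
  ultimately show "card {x \<in> tri_verts e r. tri_rank x = 0} = e + r + 1 - 1" by simp
  show "\<exists>y\<in>tri_verts e r. \<not> tri_adj e r x y \<and> tri_col e r y = c \<and> tri_rank y < tri_rank x"
    if x: "x \<in> tri_verts e r" "0 < tri_rank x" "c < e + r + 1" "c \<noteq> tri_col e r x" for x c
  proof -
    \<comment> \<open>\<open>TV\<close> is joined in \<open>H\<close> to every \<open>TB\<close> and
      \<open>TA\<close> to every \<open>TW\<close>. So \<open>TB\<close> sees the colour
      \<open>e + r\<close> on \<open>TA\<close>, whereas \<open>TW\<close> and \<open>TQ\<close> see
      it on \<open>TV\<close>.\<close>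
    define y where "y = (if c < e then TS c
      else if c < e + r then (if tri_rank x = 3 then TQ (c - e) else TP (c - e))
      else if tri_rank x = 2 \<and> tri_col e r x < e then TA else TV)"
    have "y \<in> tri_verts e r \<and> \<not> tri_adj e r x y \<and> tri_col e r y = c \<and> tri_rank y < tri_rank x"
      using x by (cases x) (auto simp: y_def mem split: if_splits)
    then show ?thesis by blast
  qed
qed

section \<open>Choice of the complement according to its degree\<close>

theorem theorem3p2:
  fixes k n :: nat
  assumes "odd k" and "k \<ge> 3" and "2 * k \<le> n" and "n \<le> 3 * k - 2"
  shows "min_defining_number n (2 * (k - 1)) k = enat (k - 1)"
proof (rule antisym)
  obtain h where k: "k = 2 * h + 1" using \<open>odd k\<close> by (rule oddE)
  \<comment> \<open>The degree of the complement, \<open>n - 1 - 2 * (k - 1)\<close>.\<close>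
  define d where "d = n + 1 - 2 * k"
  have d: "1 \<le> d" "n = 2 * (k - 1) + d + 1" "d \<le> 2 * h"
    using assms by (auto simp: d_def k)
  show "min_defining_number n (2 * (k - 1)) k \<le> enat (k - 1)"
  proof (cases "d - 1 \<le> h")
    case True
    interpret forced_coloring "bip_verts h d" "bip_adj h d" "bip_col h" bip_rank
        "insert (BT 0) (BS False ` {..<h} \<union> BW True ` {..<h})" d "2 * h + 1"
      using d(1) True by (rule bip_forced_coloring)
    show ?thesis using min_defining_number_le card_X d by (simp add: k)
  next
    case False
    define e r where "e = d - 1" and "r = 2 * h - e"
    \<comment> \<open>Here \<open>e \<ge> h + 1\<close>, hence
      \<open>r = 2 * h - e \<le> h - 1 \<le> e - 2\<close>. The gap of 2 comes from
      \<open>k - 1\<close> being even.\<close>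
    have er: "r + 2 \<le> e" "k = e + r + 1" "d = e + 1"
      using False d by (auto simp: e_def r_def k)
    interpret forced_coloring "tri_verts e r" "tri_adj e r" "tri_col e r" tri_rank
        "insert TV (TW ` {..<e} \<union> TQ ` {..<r})" "e + 1" "e + r + 1"
      using er(1) by (rule tri_forced_coloring)
    show ?thesis using min_defining_number_le card_X d(2) er(2,3) by simp
  qed
  show "enat (k - 1) \<le> min_defining_number n (2 * (k - 1)) k"
    unfolding min_defining_number_def
    by (rule INF_greatest) (use defining_number_ge in \<open>auto simp: regular_graph_def\<close>)
qed

end
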